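(* Let $\mathbf{Z}$ be a Prüfer domain of dimension $\le 1$ with explicit divisibility, and let $M\in\mathbf{Z}^{n\times n}$ be a matrix with $d=\det(M)\ne0$. Then $M$, viewed as the pseudo-matrix $(\langle1\rangle,\dots,\langle1\rangle;\langle1\rangle,\dots,\langle1\rangle;M)$, is equivalent to a pseudo-matrix of the form $$M_1=(\langle1\rangle,\dots,\langle1\rangle;\ \mathfrak{a}_1,\dots,\mathfrak{a}_n;\ \mathrm{I}_n)$$ with $\mathfrak{a}_1\supseteq\mathfrak{a}_2\supseteq\cdots\supseteq\mathfrak{a}_n$, $\prod_{i=1}^n\mathfrak{a}_i=\langle d\rangle$, and each $\mathfrak{a}_i$ of the form $\langle a_i,d\rangle$ with $a_i\in\mathbf{Z}$.
   Context: A Prüfer domain is an integral domain in which every nonzero finitely generated ideal is invertible; $\mathbf{K}$ is its field of fractions. An integral domain $\mathbf{Z}$ has dimension $\le1$ if for each $b\ne0$ the ring $\mathbf{Z}/\langle b\rangle$ is zero-dimensional, i.e. for each element $a$ there are $k\in\mathbb{N}$ and $x$ with $a^k(1-ax)=0$. "Explicit divisibility" is a constructive convention: there is an algorithm deciding divisibility in $\mathbf{Z}$. A pseudo-matrix over $\mathbf{Z}$ is a triple $M=(\mathfrak{h}_1,\dots,\mathfrak{h}_n;\mathfrak{e}_1,\dots,\mathfrak{e}_m;\underline{M})$ with $\mathfrak{h}_i$ (row indices) and $\mathfrak{e}_j$ (column indices) invertible fractional ideals and $\underline{M}=(m_{ij})\in\mathbf{K}^{n\times m}$ satisfying $m_{ij}\mathfrak{e}_j\subseteq\mathfrak{h}_i$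 for all $i,j$. The product is $(\underline{\mathfrak{c}};\underline{\mathfrak{h}};\underline{B})\cdot(\underline{\mathfrak{h}};\underline{\mathfrak{e}};\underline{A})=(\underline{\mathfrak{c}};\underline{\mathfrak{e}};\underline{B}\,\underline{A})$. A pseudo-matrix $(\underline{\mathfrak{h}};\underline{\mathfrak{e}};\underline{M})$ with as many rows as columns is invertible if $\underline{M}$ is invertible and $(\underline{\mathfrak{e}};\underline{\mathfrak{h}};\underline{M}^{-1})$ is a pseudo-matrix. Two pseudo-matrices $A,A'$ are equivalent if $A'=LAC$ for some invertible pseudo-matrices $L,C$. *)

theory Defs
  imports
    "Jordan_Normal_Form.Determinant"
    "HOL-Computational_Algebra.Polynomial_Factorial"
begin

text \<open>
  The domain \<open>\<^bold>Z\<close> is a type \<open>'a :: idom\<close>, its field of fractions \<open>\<^bold>K\<close> is \<open>'a fract\<close>,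
  and ideals of \<open>\<^bold>Z\<close> are identified with their images in \<open>\<^bold>K\<close> under \<open>to_fract\<close>.
\<close>

global_interpretation fract_mod: Modules.module "\<lambda>(a::'a::idom) (x::'a fract). to_fract a * x"
  defines frac_submodule = fract_mod.subspace
    and frac_ideal_gen = fract_mod.span
  by unfold_locales (simp_all add: algebra_simps)

definition fractional_ideal :: "'a::idom fract set \<Rightarrow> bool" where
  "fractional_ideal I \<longleftrightarrow>
     frac_submodule I \<and> (\<exists>b::'a. b \<noteq> 0 \<and> (\<forall>x\<in>I. to_fract b * x \<in> range to_fract))"

definition frac_ideal_mult :: "'a::idom fract set \<Rightarrow> 'a fract set \<Rightarrow> 'a fract set" where
  "frac_ideal_mult I J = frac_ideal_gen {x * y | x y. x \<in> I \<and> y \<in> J}"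

definition frac_ideal_prod :: "'a::idom fract set list \<Rightarrow> 'a fract set" where
  "frac_ideal_prod Is = foldr frac_ideal_mult Is (frac_ideal_gen {1})"

definition invertible_frac_ideal :: "'a::idom fract set \<Rightarrow> bool" where
  "invertible_frac_ideal I \<longleftrightarrow>
     fractional_ideal I \<and>
     (\<exists>J. fractional_ideal J \<and> frac_ideal_mult I J = frac_ideal_gen {1})"

definition pruefer_domain :: "'a::idom itself \<Rightarrow> bool" where
  "pruefer_domain _ \<longleftrightarrow>
     (\<forall>S::'a set. finite S \<longrightarrow> frac_ideal_gen (to_fract ` S) \<noteq> {0} \<longrightarrow>
        invertible_frac_ideal (frac_ideal_gen (to_fract ` S)))"

text \<open>
  The identity \<open>a\<^sup>k (1 - a x) = 0\<close> in the quotient ring \<open>\<^bold>Z / \<langle>b\<rangle>\<close> is written in \<open>\<^bold>Z\<close> as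
  divisibility of \<open>a\<^sup>k (1 - a x)\<close> by \<open>b\<close>.
\<close>

definition dimension_le_one :: "'a::idom itself \<Rightarrow> bool" where
  "dimension_le_one _ \<longleftrightarrow>
     (\<forall>b::'a. b \<noteq> 0 \<longrightarrow> (\<forall>a. \<exists>(k::nat) x. b dvd a ^ k * (1 - a * x)))"

datatype 'k pseudo_mat =
  Pseudo_Mat (row_ideals: "'k set list") (col_ideals: "'k set list")
    (entries: "'k mat")

definition is_pseudo_mat :: "'a::idom fract pseudo_mat \<Rightarrow> bool" where
  "is_pseudo_mat P \<longleftrightarrow>
     (\<forall>h\<in>set (row_ideals P). invertible_frac_ideal h) \<and>
     (\<forall>e\<in>set (col_ideals P). invertible_frac_ideal e) \<and>
     entries P \<in> carrier_mat (length (row_ideals P)) (length (col_ideals P)) \<and>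
     (\<forall>i<length (row_ideals P). \<forall>j<length (col_ideals P).
        (\<lambda>x. entries P $$ (i, j) * x) ` (col_ideals P ! j) \<subseteq> row_ideals P ! i)"

text \<open>The product is only meaningful for \<open>col_ideals P = row_ideals Q\<close>.\<close>

definition pseudo_mat_mult :: "'a::idom fract pseudo_mat \<Rightarrow> 'a fract pseudo_mat \<Rightarrow> 'a fract pseudo_mat" where
  "pseudo_mat_mult P Q =
     Pseudo_Mat (row_ideals P) (col_ideals Q) (entries P * entries Q)"

definition invertible_pseudo_mat :: "'a::idom fract pseudo_mat \<Rightarrow> bool" where
  "invertible_pseudo_mat P \<longleftrightarrow>
     is_pseudo_mat P \<and> length (row_ideals P) = length (col_ideals P) \<and>
     (\<exists>N. inverts_mat (entries P) N \<and> inverts_mat N (entries P) \<and>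
        is_pseudo_mat (Pseudo_Mat (col_ideals P) (row_ideals P) N))"

definition pseudo_mat_equiv :: "'a::idom fract pseudo_mat \<Rightarrow> 'a fract pseudo_mat \<Rightarrow> bool" where
  "pseudo_mat_equiv A A' \<longleftrightarrow>
     is_pseudo_mat A \<and> is_pseudo_mat A' \<and>
     (\<exists>L C. invertible_pseudo_mat L \<and> invertible_pseudo_mat C \<and>
        col_ideals L = row_ideals A \<and> col_ideals A = row_ideals C \<and>
        A' = pseudo_mat_mult (pseudo_mat_mult L A) C)"

end

theory Submission
  imports Defs
begin

text \<open>
  Modulo \<open>d\<close> the ring is zero-dimensional and arithmetical: each pair \<open>x\<close>, \<open>y\<close> is separated by an
  idempotent \<open>e\<close> such that \<open>x\<close> divides \<open>y\<close> where \<open>e = 0\<close>, and \<open>x\<close> is a nilpotent multiple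
  of \<open>y\<close> where \<open>e = 1\<close>. Gluing along such idempotents yields, for any matrix \<open>A\<close>, vectors \<open>p\<close>
  and \<open>q\<close> with leading entry \<open>1\<close> for which \<open>p\<^sup>T A q\<close> divides every entry of \<open>A\<close> modulo \<open>d\<close>; with
  this entry as pivot, elimination gives \<open>L M C \<equiv> diag(a\<^sub>i)\<close> modulo \<open>d\<close> with \<open>det L = det C = 1\<close>.
  The column module of \<open>L M\<close> contains \<open>d\<close> times everything, because of the adjugate, so it is the
  direct sum of the ideals \<open>\<langle>a\<^sub>i, d\<rangle>\<close>. Comparing determinants gives their product.
\<close>

subsection \<open>Divisibility modulo a nonzero element\<close>


lemma frac_ideal_gen_one: "frac_ideal_gen {1} = range (to_fract :: 'a::idom \<Rightarrow> 'a fract)"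
  by (auto simp: fract_mod.span_singleton)

text \<open>If \<open>J\<close> is the inverse of the ideal generated by \<open>x\<close> and
  \<open>y\<close>, then \<open>1 = x a + y b\<close> with \<open>a\<close>, \<open>b\<close> in
  \<open>J\<close>. The products \<open>t = x a\<close>, \<open>u = x b\<close>,
  \<open>v = y a\<close>, \<open>s = y b\<close> lie in the domain and satisfy the relations by
  commutativity.\<close>

lemma pruefer_pair:
  fixes x y :: "'a::idom"
  assumes "pruefer_domain TYPE('a)"
  obtains s t u v where "s + t = 1" "s * x = u * y" "t * y = v * x"
proof (cases "x = 0 \<and> y = 0")
  case True
  then show ?thesis using that[of 1 0 0 0] by auto
next
  case False
  let ?I = "frac_ideal_gen (to_fract ` {x, y})"
  have xI: "to_fract x \<in> ?I" and yI: "to_fract y \<in> ?I"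
    by (auto intro: fract_mod.span_base)
  have "?I \<noteq> {0}" using False xI yI by auto
  then obtain J where J: "fractional_ideal J" "frac_ideal_mult ?I J = frac_ideal_gen {1}"
    using assms unfolding pruefer_domain_def invertible_frac_ideal_def
    by (metis finite.emptyI finite_insert)
  have subJ: "frac_submodule J" using J(1) by (simp add: fractional_ideal_def)
  have integral: "\<exists>c. a * b = to_fract c" if "a \<in> ?I" "b \<in> J" for a b
  proof -
    have "a * b \<in> frac_ideal_mult ?I J" unfolding frac_ideal_mult_def
      using that by (intro fract_mod.span_base) blast
    then show ?thesis using J(2) by (auto simp: frac_ideal_gen_one)
  qed
  \<comment> \<open>This is \<open>x J + y J\<close>. Being a submodule, it contains the whole
    product ideal, so \<open>1\<close> is a sum of just two products.\<close>
  let ?W = "{to_fract x * a + to_fract y * b | a b. a \<in> J \<and> b \<in> J}"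
  have "frac_submodule ?W"
  proof (rule fract_mod.subspaceI)
    show "0 \<in> ?W" using fract_mod.subspace_0[OF subJ] by force
  next
    fix p q assume "p \<in> ?W" "q \<in> ?W"
    then obtain a b a' b' where "a \<in> J" "b \<in> J" "a' \<in> J" "b' \<in> J"
      "p = to_fract x * a + to_fract y * b" "q = to_fract x * a' + to_fract y * b'" by blast
    then have "p + q = to_fract x * (a + a') + to_fract y * (b + b')"
      "a + a' \<in> J" "b + b' \<in> J"
      using fract_mod.subspace_add[OF subJ] by (auto simp: algebra_simps)
    then show "p + q \<in> ?W" by blast
  next
    fix c p assume "p \<in> ?W"
    then obtain a b where "a \<in> J" "b \<in> J" "p = to_fract x * a + to_fract y * b" by blast
    then have "to_fract c * p = to_fract x * (to_fract c * a) + to_fract y * (to_fract c * b)"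
      "to_fract c * a \<in> J" "to_fract c * b \<in> J"
      using fract_mod.subspace_scale[OF subJ] by (auto simp: algebra_simps)
    then show "to_fract c * p \<in> ?W" by blast
  qed
  moreover have "{p * q | p q. p \<in> ?I \<and> q \<in> J} \<subseteq> ?W"
  proof safe
    fix p q assume "p \<in> ?I" and q: "q \<in> J"
    then obtain k l where "p = to_fract k * to_fract x + to_fract l * to_fract y"
      by (auto simp: fract_mod.span_insert fract_mod.span_singleton diff_eq_eq add.commute)
    then have "p * q = to_fract x * (to_fract k * q) + to_fract y * (to_fract l * q)"
      by (simp add: algebra_simps)
    then show "\<exists>a b. p * q = to_fract x * a + to_fract y * b \<and> a \<in> J \<and> b \<in> J"
      using fract_mod.subspace_scale[OF subJ q] by blast
  qed
  ultimately have "frac_ideal_mult ?I J \<subseteq> ?W"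
    unfolding frac_ideal_mult_def by (rule fract_mod.span_minimal[rotated])
  moreover have "1 \<in> frac_ideal_mult ?I J" unfolding J(2) by (simp add: fract_mod.span_base)
  ultimately obtain a b where ab: "a \<in> J" "b \<in> J" "1 = to_fract x * a + to_fract y * b" by blast
  from integral[OF xI ab(1)] integral[OF xI ab(2)] integral[OF yI ab(1)] integral[OF yI ab(2)]
  obtain t u v s where tuvs: "to_fract x * a = to_fract t" "to_fract x * b = to_fract u"
     "to_fract y * a = to_fract v" "to_fract y * b = to_fract s" by blast
  have "to_fract (s + t) = to_fract 1" using ab(3) by (simp add: tuvs add.commute)
  moreover have "to_fract (s * x) = to_fract (u * y)" "to_fract (t * y) = to_fract (v * x)"
    by (simp_all flip: tuvs)
  ultimately show ?thesis using that unfolding to_fract_eq_iff by blast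
qed

text \<open>Modulo \<open>d\<close> the ring splits at the idempotent \<open>f\<close>: where
  \<open>f = 1\<close> the element \<open>t\<close> is a unit with inverse \<open>w\<close>, and
  where \<open>f = 0\<close> it is nilpotent.\<close>

lemma power_idempotent_mod:
  fixes t :: "'a::idom"
  assumes "dimension_le_one TYPE('a)" "d \<noteq> 0"
  obtains f w k where "d dvd f - t * w" "d dvd f * (1 - f)" "d dvd (1 - f) * t ^ k"
proof -
  obtain k x where kx: "d dvd t ^ k * (1 - t * x)"
    using assms unfolding dimension_le_one_def by blast
  \<comment> \<open>The exponent exceeds \<open>k\<close> by one so that \<open>t\<close> divides
    \<open>f\<close> even for \<open>k = 0\<close>.\<close>
  define f where "f = (t * x) ^ Suc k"
  have "1 - f = (1 - t * x) * (\<Sum>i<Suc k. (t * x) ^ i)"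
    unfolding f_def by (rule one_diff_power_eq)
  then have kf: "d dvd (1 - f) * t ^ k"
    by (metis kx dvd_mult2 mult.commute mult.assoc)
  moreover have "f * (1 - f) = ((1 - f) * t ^ k) * (t * x * x ^ k)"
    by (simp add: f_def power_mult_distrib algebra_simps)
  ultimately have "d dvd f * (1 - f)" by (metis dvd_mult2)
  moreover have "f - t * (x * (t * x) ^ k) = 0" by (simp add: f_def algebra_simps)
  ultimately show ?thesis using that[of f "x * (t * x) ^ k" k] kf by simp
qed

text \<open>Divisibility in the quotient ring by \<open>d\<close>, phrased with representatives;
  equivalently, \<open>z\<close> lies in the ideal generated by \<open>x\<close> and
  \<open>d\<close>.\<close>

definition dvd_mod :: "'a::comm_ring_1 \<Rightarrow> 'a \<Rightarrow> 'a \<Rightarrow> bool" where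
  "dvd_mod d x z \<longleftrightarrow> (\<exists>m. d dvd z - m * x)"

lemma dvd_modI: "d dvd z - m * x \<Longrightarrow> dvd_mod d x z"
  by (auto simp: dvd_mod_def)

lemma dvd_mod_refl: "dvd_mod d x x"
  by (rule dvd_modI[of _ _ 1]) simp

lemma dvd_mod_of_dvd: "d dvd z \<Longrightarrow> dvd_mod d x z"
  by (rule dvd_modI[of _ _ 0]) simp

lemma dvd_mod_zero: "dvd_mod d x 0"
  by (rule dvd_mod_of_dvd) simp

lemma dvd_mod_add:
  assumes "dvd_mod d x y" "dvd_mod d x z"
  shows "dvd_mod d x (y + z)"
proof -
  from assms obtain m m' where "d dvd y - m * x" "d dvd z - m' * x" by (auto simp: dvd_mod_def)
  then have "d dvd (y - m * x) + (z - m' * x)" by (rule dvd_add)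
  then show ?thesis by (intro dvd_modI[of _ _ "m + m'"]) (simp add: algebra_simps)
qed

lemma dvd_mod_mult_left:
  assumes "dvd_mod d x y"
  shows "dvd_mod d x (c * y)"
proof -
  from assms obtain m where "d dvd y - m * x" by (auto simp: dvd_mod_def)
  then have "d dvd c * (y - m * x)" by simp
  then show ?thesis by (intro dvd_modI[of _ _ "c * m"]) (simp add: algebra_simps)
qed

lemma dvd_mod_mult_right: "dvd_mod d x y \<Longrightarrow> dvd_mod d x (y * c)"
  using dvd_mod_mult_left[of d x y c] by (simp add: mult.commute)

lemma dvd_mod_diff: "dvd_mod d x y \<Longrightarrow> dvd_mod d x z \<Longrightarrow> dvd_mod d x (y - z)"
  using dvd_mod_add[of d x y "- 1 * z"] dvd_mod_mult_left[of d x z "- 1"] by simp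

lemma dvd_mod_sum: "(\<And>i. i \<in> I \<Longrightarrow> dvd_mod d x (f i)) \<Longrightarrow> dvd_mod d x (sum f I)"
  by (induction I rule: infinite_finite_induct) (auto intro: dvd_mod_zero dvd_mod_add)

lemma dvd_mod_cong:
  assumes "dvd_mod d x y" "d dvd z - y"
  shows "dvd_mod d x z"
  using dvd_mod_add[OF assms(1) dvd_mod_of_dvd[OF assms(2)]] by simp

lemma dvd_mod_trans:
  assumes "dvd_mod d x y" "dvd_mod d y z"
  shows "dvd_mod d x z"
proof -
  from assms(2) obtain m where "d dvd z - m * y" by (auto simp: dvd_mod_def)
  then show ?thesis by (rule dvd_mod_cong[OF dvd_mod_mult_left[OF assms(1)]])
qed

subsection \<open>Pivots in zero-dimensional arithmetical rings\<close>

locale pruefer_dim_le_one =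
  fixes d :: "'a::idom"
  assumes pruefer: "pruefer_domain TYPE('a)"
    and dim_le_one: "dimension_le_one TYPE('a)"
    and d_nonzero: "d \<noteq> 0"
begin

text \<open>With \<open>s + t = 1\<close>, \<open>s x = u y\<close> and \<open>t y = v x\<close>, the idempotent \<open>e\<close> cuts out the part
  where \<open>t\<close> and \<open>u\<close> are both nilpotent. There \<open>s\<close> is a unit, so \<open>x\<close> is a nilpotent
  multiple of \<open>y\<close> and \<open>y + m x\<close> is a unit multiple of \<open>y\<close>.\<close>

lemma split_pair:
  obtains e where "d dvd e * (1 - e)" "dvd_mod d x ((1 - e) * y)"
    "\<And>m. dvd_mod d (e * (y + m * x)) (e * y)"
proof -
  obtain s t u v where stuv: "s + t = 1" "s * x = u * y" "t * y = v * x"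
    using pruefer_pair[OF pruefer] by blast
  obtain f w k where f: "d dvd f - t * w" "d dvd f * (1 - f)" "d dvd (1 - f) * t ^ k"
    using power_idempotent_mod[OF dim_le_one d_nonzero] by blast
  obtain h w' l where h: "d dvd h - u * w'" "d dvd h * (1 - h)" "d dvd (1 - h) * u ^ l"
    using power_idempotent_mod[OF dim_le_one d_nonzero] by blast
  define e where "e = (1 - f) * (1 - h)"
  have "e * (1 - e) = (f * (1 - f)) * (1 - h) ^ 2 + (h * (1 - h)) * (1 - f)"
    unfolding e_def by (simp add: algebra_simps power2_eq_square)
  then have "d dvd e * (1 - e)" using f(2) h(2) by simp
  moreover have "dvd_mod d x ((1 - e) * y)"
  proof (rule dvd_modI)
    \<comment> \<open>Here \<open>1 - e = f + (1 - f) * h\<close>. On the part \<open>f\<close> the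
      element \<open>t\<close> has inverse \<open>w\<close>, so \<open>y = w v x\<close>; on the
      part \<open>(1 - f) * h\<close> the element \<open>u\<close> has inverse \<open>w'\<close>, so
      \<open>y = w' s x\<close>.\<close>
    have "(1 - e) * y - (w * v + (1 - f) * w' * s) * x
        = (f - t * w) * y + (h - u * w') * ((1 - f) * y)"
    proof -
      have "(w * v + (1 - f) * w' * s) * x = w * (v * x) + (1 - f) * w' * (s * x)"
        by (simp add: algebra_simps)
      also have "\<dots> = w * (t * y) + (1 - f) * w' * (u * y)" by (simp only: stuv(2,3))
      finally show ?thesis unfolding e_def by (simp add: algebra_simps)
    qed
    then show "d dvd (1 - e) * y - (w * v + (1 - f) * w' * s) * x" using f(1) h(1) by simp
  qed
  moreover have "dvd_mod d (e * (y + m * x)) (e * y)" for m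
  proof -
    \<comment> \<open>Where \<open>e = 1\<close>, the power \<open>t ^ k\<close> vanishes modulo
      \<open>d\<close>, so \<open>T\<close> inverts \<open>s\<close> and \<open>x = T u y\<close>.
      Hence \<open>y + m * x = (1 - c) * y\<close> with \<open>c\<close> nilpotent, and the
      geometric sum \<open>S\<close> inverts \<open>1 - c\<close>.\<close>
    define T where "T = (\<Sum>i<k. t ^ i)"
    have T: "1 - t ^ k = s * T"
      using stuv(1) one_diff_power_eq[of t k] unfolding T_def by (simp add: algebra_simps flip: stuv(1))
    define c where "c = - (m * u * T)"
    define S where "S = (\<Sum>i<l. c ^ i)"
    have S: "1 - c ^ l = (1 - c) * S" unfolding S_def by (rule one_diff_power_eq)
    have et: "d dvd e * t ^ k" unfolding e_def using dvd_mult2[OF f(3), of "1 - h"]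
      by (simp add: mult_ac)
    have "d dvd e * u ^ l" unfolding e_def using dvd_mult2[OF h(3), of "1 - f"]
      by (simp add: mult_ac)
    then have "d dvd (e * u ^ l) * (- m * T) ^ l" by simp
    then have ec: "d dvd e * c ^ l" 
      by (simp add: c_def power_mult_distrib power_minus' mult_ac flip: power_minus)
    show ?thesis
    proof (rule dvd_modI)
      have "e * y - S * (e * (y + m * x)) = (e * c ^ l) * y - (e * t ^ k) * (S * m * x)"
      proof -
        have "e * y - (e * c ^ l) * y = e * y * (1 - c ^ l)" by (simp add: algebra_simps)
        also have "\<dots> = S * e * (y + m * T * (u * y))"
          unfolding S by (simp add: c_def algebra_simps)
        also have "\<dots> = S * e * (y + m * x * (s * T))"
          unfolding stuv(2)[symmetric] by (simp add: algebra_simps)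
        finally show ?thesis unfolding T[symmetric] by (simp add: algebra_simps)
      qed
      then show "d dvd e * y - S * (e * (y + m * x))" using ec et by (simp add: dvd_diff)
    qed
  qed
  ultimately show ?thesis using that by blast
qed

text \<open>Indices are adjoined one at a time, \<open>j0\<close> keeping its coefficient
  \<open>1\<close>. This lets \<open>q\<close> serve later as the first column of a unitriangular
  matrix.\<close>

lemma row_gcd:
  assumes "finite J" "j0 \<notin> J"
  shows "\<exists>q. q j0 = 1 \<and> (\<forall>j\<in>insert j0 J. dvd_mod d (\<Sum>j\<in>insert j0 J. w j * q j) (w j))"
  using assms
proof (induction J)
  case empty
  then show ?case by (auto intro!: exI[of _ "\<lambda>_. 1"] dvd_mod_refl)
next
  case (insert i J)
  then obtain q where q: "q j0 = 1" "\<forall>j\<in>insert j0 J. dvd_mod d (\<Sum>j\<in>insert j0 J. w j * q j) (w j)"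
    by auto
  define x where "x = (\<Sum>j\<in>insert j0 J. w j * q j)"
  obtain e where e: "d dvd e * (1 - e)" "dvd_mod d x ((1 - e) * w i)"
    "\<And>m. dvd_mod d (e * (w i + m * x)) (e * w i)" by (rule split_pair) blast
  \<comment> \<open>Where \<open>e = 0\<close>, \<open>g\<close> is \<open>x\<close>, which divides
    \<open>w i\<close>; where \<open>e = 1\<close>, \<open>g\<close> is \<open>w i + x\<close>,
    which divides \<open>w i\<close> by the case \<open>m = 1\<close> of \<open>split_pair\<close>.
    Then \<open>g\<close> also divides \<open>x = g - w i * e\<close>.\<close>
  define g where "g = w i * e + x"
  have "dvd_mod d g ((1 - e) * x)"
  proof (rule dvd_mod_cong[of _ _ "(1 - e) * g"])
    have "(1 - e) * x - (1 - e) * g = (e * (1 - e)) * (- w i)" unfolding g_def by (simp add: algebra_simps)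
    then show "d dvd (1 - e) * x - (1 - e) * g" using e(1) by (metis dvd_mult2)
  qed (intro dvd_mod_mult_left dvd_mod_refl)
  moreover obtain m where m: "d dvd (1 - e) * w i - m * x" using e(2) by (auto simp: dvd_mod_def)
  ultimately have "dvd_mod d g ((1 - e) * w i)"
  proof -
    assume a: "dvd_mod d g ((1 - e) * x)"
    have "(1 - e) * w i - m * ((1 - e) * x)
      = ((1 - e) * w i - m * x) * (1 - e) + (e * (1 - e)) * w i" by (simp add: algebra_simps)
    then have "d dvd (1 - e) * w i - m * ((1 - e) * x)" using m e(1) by (metis dvd_add dvd_mult2)
    then show ?thesis by (rule dvd_mod_cong[OF dvd_mod_mult_left[OF a]])
  qed
  moreover have "dvd_mod d g (e * w i)"
  proof (rule dvd_mod_trans[OF _ e(3)[of 1]], rule dvd_mod_cong[of _ _ "e * g"])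
    have "e * (w i + 1 * x) - e * g = (e * (1 - e)) * w i" unfolding g_def by (simp add: algebra_simps)
    then show "d dvd e * (w i + 1 * x) - e * g" using e(1) by (metis dvd_mult2)
  qed (intro dvd_mod_mult_left dvd_mod_refl)
  ultimately have "dvd_mod d g ((1 - e) * w i + e * w i)" by (rule dvd_mod_add)
  then have gw: "dvd_mod d g (w i)" by (simp add: algebra_simps)
  have "dvd_mod d g (g - w i * e)" by (intro dvd_mod_diff dvd_mod_refl dvd_mod_mult_right gw)
  then have "dvd_mod d g x" by (simp add: g_def)
  then have gj: "dvd_mod d g (w j)" if "j \<in> insert i (insert j0 J)" for j
    using that gw q(2) unfolding x_def by (auto intro: dvd_mod_trans)
  have "(\<Sum>j\<in>insert j0 (insert i J). w j * (q(i := e)) j) = g"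
  proof -
    have "i \<notin> insert j0 J" using insert by auto
    moreover from this have "(\<Sum>j\<in>insert j0 J. w j * (q(i := e)) j) = x"
      unfolding x_def by (intro sum.cong) auto
    ultimately show ?thesis using insert(1) unfolding g_def insert_commute[of j0 i]
      by (subst sum.insert) auto
  qed
  then show ?case using gj q(1) insert by (intro exI[of _ "q(i := e)"]) auto
qed

text \<open>The quantifier over \<open>g\<close> expresses that modulo \<open>d\<close> the entries of \<open>w + e v\<close> generate an
  ideal containing all entries of \<open>w\<close> and \<open>v\<close>.\<close>

lemma combine_rows:
  assumes "finite J" "j0 \<in> J"
  obtains e where "\<And>g j. (\<And>j. j \<in> J \<Longrightarrow> dvd_mod d g (w j + e * v j)) \<Longrightarrow> j \<in> J \<Longrightarrow>
    dvd_mod d g (w j) \<and> dvd_mod d g (v j)"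
proof -
  have "insert j0 (J - {j0}) = J" using assms by auto
  with row_gcd[of "J - {j0}" j0] assms have "\<And>w. \<exists>q. (\<forall>j\<in>J. dvd_mod d (\<Sum>j\<in>J. w j * q j) (w j))"
    by fastforce
  then obtain q q' where q: "\<forall>j\<in>J. dvd_mod d (\<Sum>j\<in>J. w j * q j) (w j)"
    and q': "\<forall>j\<in>J. dvd_mod d (\<Sum>j\<in>J. v j * q' j) (v j)" by blast
  define x where "x = (\<Sum>j\<in>J. w j * q j)"
  define y where "y = (\<Sum>j\<in>J. v j * q' j)"
  \<comment> \<open>Where \<open>e = 0\<close> the combined row is \<open>w\<close>, whose gcd
    \<open>x\<close> divides \<open>y\<close>. Where \<open>e = 1\<close> it is
    \<open>w + v\<close>, from which \<open>y\<close> is recovered first, and then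
    \<open>w\<close>.\<close>
  obtain e where e: "d dvd e * (1 - e)" "dvd_mod d x ((1 - e) * y)"
    "\<And>m. dvd_mod d (e * (y + m * x)) (e * y)" by (rule split_pair) blast
  have "dvd_mod d g (w j) \<and> dvd_mod d g (v j)"
    if g: "\<And>j. j \<in> J \<Longrightarrow> dvd_mod d g (w j + e * v j)" and j: "j \<in> J" for g j
  proof -
    have w1: "dvd_mod d g ((1 - e) * w j)" if "j \<in> J" for j
    proof (rule dvd_mod_cong[OF dvd_mod_mult_left[OF g[OF that]]])
      have "(1 - e) * w j - (1 - e) * (w j + e * v j) = (e * (1 - e)) * (- v j)" by (simp add: algebra_simps)
      then show "d dvd (1 - e) * w j - (1 - e) * (w j + e * v j)" using e(1) by (metis dvd_mult2)
    qed
    have "(1 - e) * x = (\<Sum>j\<in>J. (1 - e) * w j * q j)"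
      by (simp add: x_def sum_distrib_left mult.assoc)
    then have x1: "dvd_mod d g ((1 - e) * x)" by (auto intro!: dvd_mod_sum dvd_mod_mult_right w1)
    obtain m where m: "d dvd (1 - e) * y - m * x" using e(2) by (auto simp: dvd_mod_def)
    have "(1 - e) * y - m * ((1 - e) * x)
      = ((1 - e) * y - m * x) * (1 - e) + (e * (1 - e)) * y" by (simp add: algebra_simps)
    then have "d dvd (1 - e) * y - m * ((1 - e) * x)" using m e(1) by (metis dvd_add dvd_mult2)
    then have y1: "dvd_mod d g ((1 - e) * y)" by (rule dvd_mod_cong[OF dvd_mod_mult_left[OF x1]])
    \<comment> \<open>The coefficients \<open>q'\<close> turn the combined row into
      \<open>z + e * y\<close> with \<open>z\<close> congruent to some \<open>k * x\<close>. Nothing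
      is known about \<open>k\<close>, which is why \<open>split_pair\<close> provides its
      divisibility for every \<open>m\<close>.\<close>
    define z where "z = (\<Sum>j\<in>J. w j * q' j)"
    have "dvd_mod d x z" unfolding z_def using q
      by (auto intro!: dvd_mod_sum dvd_mod_mult_right simp: x_def)
    then obtain k where k: "d dvd z - k * x" by (auto simp: dvd_mod_def)
    have "(\<Sum>j\<in>J. (w j + e * v j) * q' j) = z + e * y"
      by (simp add: z_def y_def sum.distrib sum_distrib_left algebra_simps)
    moreover have "dvd_mod d g (\<Sum>j\<in>J. (w j + e * v j) * q' j)"
      by (auto intro!: dvd_mod_sum dvd_mod_mult_right g)
    ultimately have zy: "dvd_mod d g (z + e * y)" by simp
    have "dvd_mod d g (e * (y + k * x))"
    proof (rule dvd_mod_cong[OF dvd_mod_mult_left[OF zy]])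
      have "e * (y + k * x) - e * (z + e * y) = (e * (1 - e)) * y + (z - k * x) * (- e)" by (simp add: algebra_simps)
      then show "d dvd e * (y + k * x) - e * (z + e * y)"
        using e(1) k by (metis dvd_add dvd_mult2)
    qed
    then have "dvd_mod d g (e * y)" using e(3) by (rule dvd_mod_trans)
    from dvd_mod_add[OF y1 this] have "dvd_mod d g y" by (simp add: algebra_simps)
    then have v: "dvd_mod d g (v j)" using q' j by (auto simp: y_def intro: dvd_mod_trans)
    have "dvd_mod d g (w j + e * v j - e * v j)"
      by (intro dvd_mod_diff dvd_mod_mult_left g v j)
    then show ?thesis using v by simp
  qed
  then show ?thesis using that by blast
qed

text \<open>Iterates \<open>combine_rows\<close>, adding one row per step. Since the conclusion
  speaks of every common divisor \<open>g\<close>, the steps compose without computing gcds in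
  between.\<close>

lemma combine_all_rows:
  assumes "finite J" "j0 \<in> J" "finite I" "i0 \<notin> I"
  shows "\<exists>p. p i0 = 1 \<and>
    (\<forall>g. (\<forall>j\<in>J. dvd_mod d g (\<Sum>i\<in>insert i0 I. p i * A i j)) \<longrightarrow>
       (\<forall>i\<in>insert i0 I. \<forall>j\<in>J. dvd_mod d g (A i j)))"
  using assms(3,4)
proof (induction I)
  case empty
  then show ?case by (auto intro!: exI[of _ "\<lambda>_. 1"])
next
  case (insert k I)
  then obtain p where p: "p i0 = 1" "\<And>g. (\<forall>j\<in>J. dvd_mod d g (\<Sum>i\<in>insert i0 I. p i * A i j)) \<Longrightarrow>
       (\<forall>i\<in>insert i0 I. \<forall>j\<in>J. dvd_mod d g (A i j))" by auto
  obtain e where e: "\<And>g j. (\<And>j. j \<in> J \<Longrightarrow> 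
      dvd_mod d g ((\<Sum>i\<in>insert i0 I. p i * A i j) + e * A k j)) \<Longrightarrow> j \<in> J \<Longrightarrow>
    dvd_mod d g (\<Sum>i\<in>insert i0 I. p i * A i j) \<and> dvd_mod d g (A k j)"
    using combine_rows[OF assms(1,2), of "\<lambda>j. \<Sum>i\<in>insert i0 I. p i * A i j" "A k"] by metis
  have k: "k \<notin> insert i0 I" using insert by auto
  have eq: "(\<Sum>i\<in>insert i0 (insert k I). (p(k := e)) i * A i j)
    = (\<Sum>i\<in>insert i0 I. p i * A i j) + e * A k j" for j
  proof -
    from k have "(\<Sum>i\<in>insert i0 I. (p(k := e)) i * A i j) = (\<Sum>i\<in>insert i0 I. p i * A i j)"
      by (intro sum.cong) auto
    with k show ?thesis using insert(1) unfolding insert_commute[of i0 k]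
      by (subst sum.insert) auto
  qed
  have "dvd_mod d g (A i j)"
    if g: "\<forall>j\<in>J. dvd_mod d g (\<Sum>i\<in>insert i0 (insert k I). (p(k := e)) i * A i j)"
      and ij: "i \<in> insert i0 (insert k I)" "j \<in> J" for g i j
  proof -
    have "dvd_mod d g (\<Sum>i\<in>insert i0 I. p i * A i j) \<and> dvd_mod d g (A k j)" if "j \<in> J" for j
      using e[OF _ that] g unfolding eq by blast
    then show ?thesis using p(2) ij by blast
  qed
  moreover have "(p(k := e)) i0 = 1" using p(1) k by auto
  ultimately show ?case by blast
qed

text \<open>The rows are first combined into one by \<open>p\<close>; then \<open>row_gcd\<close>
  supplies \<open>q\<close> and a gcd of that row, which by the choice of \<open>p\<close> divides
  the whole matrix modulo \<open>d\<close>.\<close>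

lemma pivot:
  obtains p q where "p 0 = 1" "q 0 = 1"
    "\<And>i j. i < Suc m \<Longrightarrow> j < Suc n \<Longrightarrow>
      dvd_mod d (\<Sum>j<Suc n. (\<Sum>i<Suc m. p i * A i j) * q j) (A i j)"
proof -
  have ins: "insert 0 {1..<Suc n} = {..<Suc n}" for n :: nat by auto
  obtain p where p: "p 0 = 1"
    "\<And>g. (\<forall>j<Suc n. dvd_mod d g (\<Sum>i<Suc m. p i * A i j)) \<Longrightarrow>
       (\<forall>i<Suc m. \<forall>j<Suc n. dvd_mod d g (A i j))"
    using combine_all_rows[of "{..<Suc n}" 0 "{1..<Suc m}" 0 A, unfolded ins] by auto
  obtain q where q: "q 0 = 1" "\<forall>j<Suc n. dvd_mod d
     (\<Sum>j<Suc n. (\<Sum>i<Suc m. p i * A i j) * q j) (\<Sum>i<Suc m. p i * A i j)"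
    using row_gcd[of "{1..<Suc n}" 0 "\<lambda>j. \<Sum>i<Suc m. p i * A i j", unfolded ins] by auto
  show ?thesis using that[of p q] p q by blast
qed

end

subsection \<open>Smith normal form modulo \<open>d\<close>\<close>


lemma index_mult_mat_sum:
  assumes "A \<in> carrier_mat nr n" "B \<in> carrier_mat n nc" "i < nr" "j < nc"
  shows "(A * B) $$ (i, j) = (\<Sum>k<n. A $$ (i, k) * B $$ (k, j))"
  using assms by (simp add: scalar_prod_def atLeast0LessThan)

lemma det_unitriangular:
  assumes "U \<in> carrier_mat n n" "\<And>i. i < n \<Longrightarrow> U $$ (i, i) = 1"
    and "upper_triangular U \<or> upper_triangular (transpose_mat U)"
  shows "det U = (1 :: 'a::comm_ring_1)"
proof -
  have "prod_list (diag_mat U) = 1" using assms(1,2) by (simp add: prod_list_diag_prod)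
  then show ?thesis
    using assms det_upper_triangular[of U n] det_upper_triangular[of "transpose_mat U" n]
      det_transpose[of U n] by auto
qed

text \<open>\<open>L\<close> is the identity with first row replaced by \<open>p\<close>,
  unitriangular because \<open>p 0 = 1\<close>.\<close>

lemma row_combination_mat:
  fixes B :: "'a::comm_ring_1 mat"
  assumes "B \<in> carrier_mat (Suc n) (Suc n)" "p 0 = 1"
  obtains L where "L \<in> carrier_mat (Suc n) (Suc n)" "det L = 1"
    "\<And>j. j < Suc n \<Longrightarrow> (L * B) $$ (0, j) = (\<Sum>i<Suc n. p i * B $$ (i, j))"
proof -
  define L where "L = mat (Suc n) (Suc n)
    (\<lambda>(i, j). if i = 0 then p j else if i = j then 1 else 0)"
  have "det L = 1"
    by (rule det_unitriangular[of _ "Suc n"]) (auto simp: L_def upper_triangular_def assms(2))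
  moreover have "(L * B) $$ (0, j) = (\<Sum>i<Suc n. p i * B $$ (i, j))" if "j < Suc n" for j
    using that assms(1) by (subst index_mult_mat_sum[of _ "Suc n" "Suc n" _ "Suc n"])
      (auto simp: L_def intro!: sum.cong)
  moreover have "L \<in> carrier_mat (Suc n) (Suc n)" by (simp add: L_def)
  ultimately show ?thesis using that by blast
qed

text \<open>\<open>L\<close> is the identity with \<open>- c i\<close> placed below the corner in
  the first column.\<close>

lemma row_clearing_mat:
  fixes B :: "'a::comm_ring_1 mat"
  assumes "B \<in> carrier_mat (Suc n) (Suc n)"
  obtains L where "L \<in> carrier_mat (Suc n) (Suc n)" "det L = 1"
    "\<And>j. j < Suc n \<Longrightarrow> (L * B) $$ (0, j) = B $$ (0, j)"
    "\<And>i j. 0 < i \<Longrightarrow> i < Suc n \<Longrightarrow> j < Suc n \<Longrightarrow> (L * B) $$ (i, j) = B $$ (i, j) - c i * B $$ (0, j)"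
proof -
  define L where "L = mat (Suc n) (Suc n)
    (\<lambda>(i, j). if i = j then 1 else if j = 0 then - c i else 0)"
  have L: "L \<in> carrier_mat (Suc n) (Suc n)" by (simp add: L_def)
  have "det L = 1"
    by (rule det_unitriangular[of _ "Suc n"]) (auto simp: L_def upper_triangular_def)
  moreover have "(L * B) $$ (i, j) = B $$ (i, j) + (if i = 0 then 0 else - c i * B $$ (0, j))"
    if "i < Suc n" "j < Suc n" for i j
  proof -
    have "(L * B) $$ (i, j) = (\<Sum>k<Suc n. L $$ (i, k) * B $$ (k, j))"
      using that by (rule index_mult_mat_sum[OF L assms])
    also have "\<dots> = (\<Sum>k<Suc n. (if k = i then B $$ (k, j) else 0)
        + (if k = 0 then if i = 0 then 0 else - c i * B $$ (0, j) else 0))"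
      using that by (intro sum.cong) (auto simp: L_def)
    also have "\<dots> = B $$ (i, j) + (if i = 0 then 0 else - c i * B $$ (0, j))"
      using that by (simp only: sum.distrib sum.delta) simp
    finally show ?thesis .
  qed
  ultimately show ?thesis using that L by simp
qed

text \<open>Follows from the row version by transposition.\<close>

lemma col_combination_mat:
  fixes B :: "'a::comm_ring_1 mat"
  assumes B: "B \<in> carrier_mat (Suc n) (Suc n)" and "q 0 = 1"
  obtains C where "C \<in> carrier_mat (Suc n) (Suc n)" "det C = 1"
    "\<And>i. i < Suc n \<Longrightarrow> (B * C) $$ (i, 0) = (\<Sum>j<Suc n. B $$ (i, j) * q j)"
proof -
  obtain L where L: "L \<in> carrier_mat (Suc n) (Suc n)" "det L = 1"
    "\<And>j. j < Suc n \<Longrightarrow> (L * transpose_mat B) $$ (0, j) = (\<Sum>i<Suc n. q i * transpose_mat B $$ (i, j))"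
    using row_combination_mat[of "transpose_mat B" n q] assms by auto
  have "(B * transpose_mat L) $$ (i, 0) = (\<Sum>j<Suc n. B $$ (i, j) * q j)" if "i < Suc n" for i
  proof -
    have "B * transpose_mat L = transpose_mat (L * transpose_mat B)"
      using transpose_mult[OF L(1) transpose_carrier_mat[THEN iffD2, OF B]] by simp
    then have "(B * transpose_mat L) $$ (i, 0) = (L * transpose_mat B) $$ (0, i)"
      using that B L(1) by (simp del: index_mult_mat(1))
    also have "\<dots> = (\<Sum>j<Suc n. B $$ (i, j) * q j)"
      unfolding L(3)[OF that] using that B by (intro sum.cong) (auto simp: mult.commute)
    finally show ?thesis .
  qed
  then show ?thesis using that[of "transpose_mat L"] L det_transpose[OF L(1)] by auto
qed

lemma col_clearing_mat:
  fixes B :: "'a::comm_ring_1 mat"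
  assumes B: "B \<in> carrier_mat (Suc n) (Suc n)"
  obtains C where "C \<in> carrier_mat (Suc n) (Suc n)" "det C = 1"
    "\<And>i. i < Suc n \<Longrightarrow> (B * C) $$ (i, 0) = B $$ (i, 0)"
    "\<And>i j. i < Suc n \<Longrightarrow> 0 < j \<Longrightarrow> j < Suc n \<Longrightarrow> (B * C) $$ (i, j) = B $$ (i, j) - c j * B $$ (i, 0)"
proof -
  obtain L where L: "L \<in> carrier_mat (Suc n) (Suc n)" "det L = 1"
    "\<And>j. j < Suc n \<Longrightarrow> (L * transpose_mat B) $$ (0, j) = transpose_mat B $$ (0, j)"
    "\<And>i j. 0 < i \<Longrightarrow> i < Suc n \<Longrightarrow> j < Suc n \<Longrightarrow>
      (L * transpose_mat B) $$ (i, j) = transpose_mat B $$ (i, j) - c i * transpose_mat B $$ (0, j)"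
    using row_clearing_mat[of "transpose_mat B" n c] assms by auto
  have "B * transpose_mat L = transpose_mat (L * transpose_mat B)"
    using transpose_mult[OF L(1) transpose_carrier_mat[THEN iffD2, OF B]] by simp
  then have eq: "(B * transpose_mat L) $$ (i, j) = (L * transpose_mat B) $$ (j, i)"
    if "i < Suc n" "j < Suc n" for i j
    using that B L(1) by (simp del: index_mult_mat(1))
  show ?thesis
  proof (rule that[of "transpose_mat L"])
    show "(B * transpose_mat L) $$ (i, 0) = B $$ (i, 0)" if "i < Suc n" for i
      using that B by (simp add: eq L del: index_mult_mat(1))
    show "(B * transpose_mat L) $$ (i, j) = B $$ (i, j) - c j * B $$ (i, 0)"
      if "i < Suc n" "0 < j" "j < Suc n" for i j
      using that B by (simp add: eq L del: index_mult_mat(1))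
  qed (use L det_transpose[OF L(1)] in auto)
qed

lemma dvd_mod_mat_mult:
  assumes "L \<in> carrier_mat n n" "A \<in> carrier_mat n n" "C \<in> carrier_mat n n"
    and A: "\<And>i j. i < n \<Longrightarrow> j < n \<Longrightarrow> dvd_mod d g (A $$ (i, j))"
    and "i < n" "j < n"
  shows "dvd_mod d g ((L * A * C) $$ (i, j))"
proof -
  have "dvd_mod d g ((L * A) $$ (i, k))" if "k < n" for k
    using assms that by (subst index_mult_mat_sum[of _ n n _ n])
      (auto intro!: dvd_mod_sum dvd_mod_mult_left)
  then show ?thesis
    using assms by (subst index_mult_mat_sum[of _ n n _ n])
      (auto intro!: dvd_mod_sum dvd_mod_mult_right simp del: index_mult_mat(1))
qed

section \<open>Elimination with the pivot and induction on the size\<close>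

context pruefer_dim_le_one
begin

lemma smith_step:
  fixes A :: "'a mat"
  assumes A: "A \<in> carrier_mat (Suc n) (Suc n)"
  obtains L C where "L \<in> carrier_mat (Suc n) (Suc n)" "C \<in> carrier_mat (Suc n) (Suc n)"
    "det L = 1" "det C = 1"
    "\<And>i j. i < Suc n \<Longrightarrow> j < Suc n \<Longrightarrow> dvd_mod d ((L * A * C) $$ (0, 0)) ((L * A * C) $$ (i, j))"
    "\<And>i. 0 < i \<Longrightarrow> i < Suc n \<Longrightarrow> d dvd (L * A * C) $$ (i, 0)"
    "\<And>j. 0 < j \<Longrightarrow> j < Suc n \<Longrightarrow> d dvd (L * A * C) $$ (0, j)"
proof -
  let ?N = "Suc n"
  note [simp del] = index_mult_mat(1)
  obtain p q where pq: "p 0 = 1" "q 0 = 1" "\<And>i j. i < ?N \<Longrightarrow> j < ?N \<Longrightarrow>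
      dvd_mod d (\<Sum>j<?N. (\<Sum>i<?N. p i * A $$ (i, j)) * q j) (A $$ (i, j))"
    by (rule pivot[where A = "\<lambda>i j. A $$ (i, j)" and m = n and n = n]) blast
  define g where "g = (\<Sum>j<?N. (\<Sum>i<?N. p i * A $$ (i, j)) * q j)"
  obtain L0 where L0: "L0 \<in> carrier_mat ?N ?N" "det L0 = 1"
    "\<And>j. j < ?N \<Longrightarrow> (L0 * A) $$ (0, j) = (\<Sum>i<?N. p i * A $$ (i, j))"
    using row_combination_mat[of A n p] A pq(1) by blast
  have L0A: "L0 * A \<in> carrier_mat ?N ?N" using L0 A by simp
  obtain C0 where C0: "C0 \<in> carrier_mat ?N ?N" "det C0 = 1"
    "\<And>i. i < ?N \<Longrightarrow> (L0 * A * C0) $$ (i, 0) = (\<Sum>j<?N. (L0 * A) $$ (i, j) * q j)"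
    using col_combination_mat[of "L0 * A" n q] L0A pq(2) by blast
  define B where "B = L0 * A * C0"
  have B: "B \<in> carrier_mat ?N ?N" using L0A C0 by (simp add: B_def)
  have B00: "B $$ (0, 0) = g" using C0(3)[of 0] L0(3) by (simp add: B_def g_def)
  have gB: "dvd_mod d g (B $$ (i, j))" if "i < ?N" "j < ?N" for i j
    unfolding B_def by (rule dvd_mod_mat_mult[OF L0(1) A C0(1) _ that]) (simp only: g_def pq(3))
  \<comment> \<open>The multipliers for clearing are the quotients of the first column and first row
    by the pivot \<open>g\<close>, modulo \<open>d\<close>.\<close>
  have "\<forall>i\<in>{..<?N}. \<exists>c. d dvd B $$ (i, 0) - c * g" 
    using gB by (auto simp: dvd_mod_def)
  then obtain c where c: "\<And>i. i < ?N \<Longrightarrow> d dvd B $$ (i, 0) - c i * g"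
    unfolding bchoice_iff by auto
  have "\<forall>j\<in>{..<?N}. \<exists>c. d dvd B $$ (0, j) - c * g" 
    using gB by (auto simp: dvd_mod_def)
  then obtain c' where c': "\<And>j. j < ?N \<Longrightarrow> d dvd B $$ (0, j) - c' j * g"
    unfolding bchoice_iff by auto
  obtain L1 where L1: "L1 \<in> carrier_mat ?N ?N" "det L1 = 1"
    "\<And>j. j < ?N \<Longrightarrow> (L1 * B) $$ (0, j) = B $$ (0, j)"
    "\<And>i j. 0 < i \<Longrightarrow> i < ?N \<Longrightarrow> j < ?N \<Longrightarrow> (L1 * B) $$ (i, j) = B $$ (i, j) - c i * B $$ (0, j)"
    using row_clearing_mat[OF B, of c] by blast
  have L1B: "L1 * B \<in> carrier_mat ?N ?N" using L1 B by simp
  \<comment> \<open>Row clearing leaves row \<open>0\<close> unchanged, so the quotients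
    \<open>c'\<close> computed from \<open>B\<close> still fit; column clearing in turn leaves
    column \<open>0\<close> unchanged.\<close>
  obtain C1 where C1: "C1 \<in> carrier_mat ?N ?N" "det C1 = 1"
    "\<And>i. i < ?N \<Longrightarrow> (L1 * B * C1) $$ (i, 0) = (L1 * B) $$ (i, 0)"
    "\<And>i j. i < ?N \<Longrightarrow> 0 < j \<Longrightarrow> j < ?N \<Longrightarrow>
      (L1 * B * C1) $$ (i, j) = (L1 * B) $$ (i, j) - c' j * (L1 * B) $$ (i, 0)"
    using col_clearing_mat[OF L1B, of c'] by blast
  have "L1 * B * C1 = (L1 * L0) * A * (C0 * C1)"
    unfolding B_def using L0(1) L1(1) C0(1) C1(1) A L0A
    by (simp add: assoc_mult_mat[of _ ?N ?N _ ?N _ ?N])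
  moreover have "det (L1 * L0) = 1" "det (C0 * C1) = 1"
    using L0 L1 C0 C1 by (simp_all add: det_mult[of _ ?N])
  moreover have D00: "(L1 * B * C1) $$ (0, 0) = g" by (simp add: C1 L1 B00)
  moreover have "dvd_mod d g ((L1 * B * C1) $$ (i, j))" if "i < ?N" "j < ?N" for i j
    using dvd_mod_mat_mult[OF L1(1) B C1(1) gB that] .
  moreover have "d dvd (L1 * B * C1) $$ (i, 0)" if "0 < i" "i < ?N" for i
    using that c[of i] by (simp add: C1 L1 B00)
  moreover have "d dvd (L1 * B * C1) $$ (0, j)" if "0 < j" "j < ?N" for j
    using that c'[of j] by (simp add: C1 L1 B00)
  ultimately show ?thesis using that[of "L1 * L0" "C0 * C1"] L0(1) L1(1) C0(1) C1(1)
    by simp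
qed

text \<open>After \<open>smith_step\<close> the induction hypothesis is applied to the block
  \<open>T\<close> complementary to the pivot. Determinant \<open>1\<close> makes the adjugates of
  \<open>L\<close> and \<open>C\<close> their inverses.\<close>

lemma smith_normal_form_mod:
  fixes A :: "'a mat"
  assumes "A \<in> carrier_mat n n"
  shows "\<exists>L C. L \<in> carrier_mat n n \<and> C \<in> carrier_mat n n \<and> det L = 1 \<and> det C = 1 \<and>
    (\<forall>i<n. \<forall>j<n. i \<noteq> j \<longrightarrow> d dvd (L * A * C) $$ (i, j)) \<and>
    (\<forall>i j. i < j \<longrightarrow> j < n \<longrightarrow> dvd_mod d ((L * A * C) $$ (i, i)) ((L * A * C) $$ (j, j)))"
  using assms
proof (induction n arbitrary: A)
  case 0
  then show ?case by (intro exI[of _ "1\<^sub>m 0"]) auto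
next
  case (Suc n)
  let ?N = "Suc n"
  note [simp del] = index_mult_mat(1)
  obtain L1 C1 where 1: "L1 \<in> carrier_mat ?N ?N" "C1 \<in> carrier_mat ?N ?N"
    "det L1 = 1" "det C1 = 1"
    "\<And>i j. i < ?N \<Longrightarrow> j < ?N \<Longrightarrow> dvd_mod d ((L1 * A * C1) $$ (0, 0)) ((L1 * A * C1) $$ (i, j))"
    "\<And>i. 0 < i \<Longrightarrow> i < ?N \<Longrightarrow> d dvd (L1 * A * C1) $$ (i, 0)"
    "\<And>j. 0 < j \<Longrightarrow> j < ?N \<Longrightarrow> d dvd (L1 * A * C1) $$ (0, j)"
    using smith_step[OF Suc.prems] by blast
  define B where "B = L1 * A * C1"
  have B: "B \<in> carrier_mat ?N ?N" using 1 Suc.prems by (simp add: B_def)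
  define b r c T where "b = mat 1 1 (\<lambda>_. B $$ (0, 0))"
    and "r = mat 1 n (\<lambda>(_, j). B $$ (0, Suc j))"
    and "c = mat n 1 (\<lambda>(i, _). B $$ (Suc i, 0))"
    and "T = mat n n (\<lambda>(i, j). B $$ (Suc i, Suc j))"
  have dims: "b \<in> carrier_mat 1 1" "r \<in> carrier_mat 1 n" "c \<in> carrier_mat n 1" "T \<in> carrier_mat n n"
    by (simp_all add: b_def r_def c_def T_def)
  have Bblock: "B = four_block_mat b r c T"
    by (rule eq_matI) (use B in \<open>auto simp: b_def r_def c_def T_def\<close>)
  obtain L2 C2 where 2: "L2 \<in> carrier_mat n n" "C2 \<in> carrier_mat n n" "det L2 = 1" "det C2 = 1"
    "\<And>i j. i < n \<Longrightarrow> j < n \<Longrightarrow> i \<noteq> j \<Longrightarrow> d dvd (L2 * T * C2) $$ (i, j)"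
    "\<And>i j. i < j \<Longrightarrow> j < n \<Longrightarrow> dvd_mod d ((L2 * T * C2) $$ (i, i)) ((L2 * T * C2) $$ (j, j))"
    using Suc.IH[OF dims(4)] by blast
  let ?E = "\<lambda>X. four_block_mat (1\<^sub>m 1) (0\<^sub>m 1 n) (0\<^sub>m n 1) X"
  have E: "?E X \<in> carrier_mat ?N ?N" "det (?E X) = det X" if "X \<in> carrier_mat n n" for X :: "'a mat"
    using that four_block_carrier_mat[of "1\<^sub>m 1" 1 1 X n n]
      det_four_block_mat_lower_left_zero[of "1\<^sub>m 1" 1 "0\<^sub>m 1 n" n "0\<^sub>m n 1" X] by auto
  define D where "D = ?E L2 * B * ?E C2"
  have D: "D = four_block_mat b (r * C2) (L2 * c) (L2 * T * C2)"
    unfolding D_def Bblock using 2(1,2) dims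
    by (simp add: mult_four_block_mat[of _ 1 1 _ n _ n _ _ 1 _ n])
  have eq: "(?E L2 * L1) * A * (C1 * ?E C2) = D"
    unfolding D_def B_def using 1(1,2) E(1)[OF 2(1)] E(1)[OF 2(2)] Suc.prems
    by (simp add: assoc_mult_mat[of _ ?N ?N _ ?N _ ?N])
  have dr: "d dvd (r * C2) $$ (0, j)" if "j < n" for j
    using that 1(7) 2(2) dims(2) by (subst index_mult_mat_sum[of _ 1 n _ n])
      (auto intro!: dvd_sum dvd_mult2 simp: r_def simp flip: B_def)
  have dc: "d dvd (L2 * c) $$ (i, 0)" if "i < n" for i
    using that 1(6) 2(1) dims(3) by (subst index_mult_mat_sum[of _ n n _ 1])
      (auto intro!: dvd_sum dvd_mult simp: c_def simp flip: B_def)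
  \<comment> \<open>The pivot divides all of \<open>T\<close> modulo \<open>d\<close>, hence also
    the new diagonal; this puts it at the head of the divisibility chain.\<close>
  have gT: "dvd_mod d (B $$ (0, 0)) ((L2 * T * C2) $$ (i, i))" if "i < n" for i
    using that by (intro dvd_mod_mat_mult[OF 2(1) dims(4) 2(2)])
      (auto simp: T_def B_def intro: 1(5))
  have D_index: "D $$ (i, j) = (case i of 0 \<Rightarrow> (case j of 0 \<Rightarrow> B $$ (0, 0) | Suc j' \<Rightarrow> (r * C2) $$ (0, j'))
      | Suc i' \<Rightarrow> (case j of 0 \<Rightarrow> (L2 * c) $$ (i', 0) | Suc j' \<Rightarrow> (L2 * T * C2) $$ (i', j')))"
    if "i < ?N" "j < ?N" for i j
    using that 2(1,2) dims unfolding D by (auto simp: b_def split: nat.split)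
  have "d dvd D $$ (i, j)" if "i < ?N" "j < ?N" "i \<noteq> j" for i j
    using that dr dc 2(5) by (auto simp: D_index split: nat.split)
  moreover have "dvd_mod d (D $$ (i, i)) (D $$ (j, j))" if "i < j" "j < ?N" for i j
    using that gT 2(6) by (auto simp: D_index split: nat.split)
  moreover have "det (?E L2 * L1) = 1" "det (C1 * ?E C2) = 1"
    using 1 2 E by (simp_all add: det_mult[of _ ?N])
  ultimately show ?case using 1(1,2) E(1)[OF 2(1)] E(1)[OF 2(2)]
    by (intro exI[of _ "?E L2 * L1"] exI[of _ "C1 * ?E C2"]) (simp only: eq, simp)
qed

end

subsection \<open>Passage to pseudo-matrices\<close>


lemma one_smult_mat: "1 \<cdot>\<^sub>m A = (A :: 'a::monoid_mult mat)"
  by (rule eq_matI) auto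

lemma frac_ideal_gen_pair:
  "frac_ideal_gen {to_fract a, to_fract d} = to_fract ` {z. dvd_mod d a z}"
proof (rule equalityI; rule subsetI)
  fix x assume "x \<in> frac_ideal_gen {to_fract a, to_fract d}"
  then obtain k l where "x - to_fract k * to_fract a = to_fract l * to_fract d"
    by (auto simp: fract_mod.span_insert fract_mod.span_singleton)
  then have "x = to_fract (k * a + l * d)" by (simp add: diff_eq_eq add.commute)
  moreover have "dvd_mod d a (k * a + l * d)" by (rule dvd_modI[of _ _ k]) simp
  ultimately show "x \<in> to_fract ` {z. dvd_mod d a z}" by blast
next
  fix x assume "x \<in> to_fract ` {z. dvd_mod d a z}"
  then obtain m l where "x = to_fract (m * a + l * d)"
    by (auto simp: dvd_mod_def dvd_def diff_eq_eq mult.commute[of d] add.commute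
        simp del: to_fract_add to_fract_mult)
  then show "x \<in> frac_ideal_gen {to_fract a, to_fract d}"
    by (auto intro!: fract_mod.span_add fract_mod.span_scale intro: fract_mod.span_base)
qed

section \<open>Products of ideals and determinants\<close>

lemma prod_list_in_frac_ideal_prod:
  "list_all2 (\<in>) xs Is \<Longrightarrow> prod_list xs \<in> frac_ideal_prod Is"
proof (induction rule: list_all2_induct)
  case Nil
  then show ?case by (simp add: frac_ideal_prod_def fract_mod.span_base)
next
  case (Cons x xs I Is)
  have "frac_ideal_prod (I # Is) = frac_ideal_mult I (frac_ideal_prod Is)"
    by (simp add: frac_ideal_prod_def)
  then show ?case using Cons
    by (auto simp: frac_ideal_mult_def intro!: fract_mod.span_base)
qed

lemma frac_submodule_frac_ideal_prod: "frac_submodule (frac_ideal_prod Is)"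
  by (cases Is) (simp_all add: frac_ideal_prod_def frac_ideal_mult_def fract_mod.subspace_span)

text \<open>Reduces membership to products with one element from each ideal. The factor
  \<open>c\<close> accumulates the elements already chosen, so it has to vary in the
  induction.\<close>

lemma frac_ideal_prod_induct:
  assumes S: "frac_submodule S"
    and "\<And>xs. list_all2 (\<in>) xs Is \<Longrightarrow> c * prod_list xs \<in> S" "y \<in> frac_ideal_prod Is"
  shows "c * y \<in> S"
  using assms(2,3)
proof (induction Is arbitrary: c y)
  case Nil
  from Nil(2) obtain k where "y = to_fract k"
    by (auto simp: frac_ideal_prod_def frac_ideal_gen_one)
  then show ?case using fract_mod.subspace_scale[OF S, of c k] Nil(1)[of "[]"]
    by (simp add: mult.commute)
next
  case (Cons I Is)
  have sub: "frac_submodule {z. c * z \<in> S}"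
    using fract_mod.subspace_0[OF S] fract_mod.subspace_add[OF S] fract_mod.subspace_scale[OF S]
    by (intro fract_mod.subspaceI) (auto simp: distrib_left mult.left_commute[of c])
  have "{x * z | x z. x \<in> I \<and> z \<in> frac_ideal_prod Is} \<subseteq> {z. c * z \<in> S}"
  proof safe
    fix x z assume x: "x \<in> I" and z: "z \<in> frac_ideal_prod Is"
    have "c * x * prod_list xs \<in> S" if "list_all2 (\<in>) xs Is" for xs
      using Cons.prems(1)[of "x # xs"] that x by (simp add: mult.assoc)
    then have "c * x * z \<in> S" using z by (rule Cons.IH)
    then show "c * (x * z) \<in> S" by (simp add: mult.assoc)
  qed
  from fract_mod.span_minimal[OF this sub] show ?case using Cons.prems(2)
    by (auto simp: frac_ideal_prod_def frac_ideal_mult_def)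
qed

text \<open>Each term of the Leibniz formula takes exactly one entry from every row.\<close>

lemma det_in_frac_ideal_prod:
  fixes P :: "'a::idom mat"
  assumes "P \<in> carrier_mat n n"
    and "\<And>i j. i < n \<Longrightarrow> j < n \<Longrightarrow> to_fract (P $$ (i, j)) \<in> I i"
  shows "to_fract (det P) \<in> frac_ideal_prod (map I [0..<n])"
proof -
  interpret to_fract: comm_ring_hom "to_fract :: 'a \<Rightarrow> 'a fract" by unfold_locales simp_all
  have "to_fract (\<Prod>i = 0..<n. P $$ (i, p i)) \<in> frac_ideal_prod (map I [0..<n])"
    if "p permutes {0..<n}" for p
  proof -
    let ?xs = "map (\<lambda>i. to_fract (P $$ (i, p i))) [0..<n]"
    have "list_all2 (\<in>) ?xs (map I [0..<n])"
      using assms(2) permutes_in_image[OF that] by (auto simp: list_all2_conv_all_nth)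
    moreover have "prod_list ?xs = to_fract (\<Prod>i = 0..<n. P $$ (i, p i))"
      by (simp add: to_fract.hom_prod prod.list_conv_set_nth)
    ultimately show ?thesis using prod_list_in_frac_ideal_prod by metis
  qed
  then have "to_fract (\<Sum>p | p permutes {0..<n}. signof p * (\<Prod>i = 0..<n. P $$ (i, p i)))
      \<in> frac_ideal_prod (map I [0..<n])"
    unfolding to_fract.hom_sum to_fract_mult
    by (intro fract_mod.subspace_sum fract_mod.subspace_scale frac_submodule_frac_ideal_prod) auto
  then show ?thesis by (simp add: det_def'[OF assms(1)])
qed

text \<open>If \<open>P\<close> has determinant \<open>d\<close>, then divisibility of \<open>adj P * diag b\<close> by \<open>d\<close> says that the
  columns of \<open>diag b\<close> lie in the column module of \<open>P\<close>.\<close>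

lemma det_dvd_prod:
  fixes P :: "'a::idom mat"
  assumes P: "P \<in> carrier_mat n n" and "det P \<noteq> 0"
    and dvd: "\<And>i j. i < n \<Longrightarrow> j < n \<Longrightarrow> det P dvd adj_mat P $$ (i, j) * b j"
  shows "det P dvd (\<Prod>i = 0..<n. b i)"
proof -
  let ?Y = "adj_mat P" and ?d = "det P"
  note Y = adj_mat[OF P]
  have "\<forall>ij. \<exists>w. fst ij < n \<and> snd ij < n \<longrightarrow> ?Y $$ ij * b (snd ij) = ?d * w"
    using dvd by (auto simp: dvd_def)
  then obtain w where w: "\<And>i j. i < n \<Longrightarrow> j < n \<Longrightarrow> ?Y $$ (i, j) * b j = ?d * w (i, j)"
    by (metis fst_conv snd_conv)
  have "?Y * mat_diag n b = ?d \<cdot>\<^sub>m mat n n w"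
    using Y(1) w by (intro eq_matI) (auto simp: mat_diag_mult_right[OF Y(1)])
  then have "det (?Y * mat_diag n b) = ?d ^ n * det (mat n n w)" by simp
  moreover have "det (mat_diag n b) = (\<Prod>i = 0..<n. b i)"
    by (subst det_upper_triangular[of _ n])
      (auto simp: mat_diag_def upper_triangular_def prod_list_diag_prod)
  ultimately have 1: "det ?Y * (\<Prod>i = 0..<n. b i) = ?d ^ n * det (mat n n w)"
    by (simp add: det_mult[OF Y(1)])
  \<comment> \<open>The relation \<open>det ?Y * ?d = ?d ^ n\<close> avoids the exponent
    \<open>n - 1\<close>; the nonzero factor \<open>?d ^ n\<close> is cancelled at the end.\<close>
  have "det (?Y * P) = ?d ^ n" by (simp add: Y(3))
  then have 2: "det ?Y * ?d = ?d ^ n" by (simp add: det_mult[OF Y(1) P])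
  have "?d ^ n * (\<Prod>i = 0..<n. b i) = (det ?Y * (\<Prod>i = 0..<n. b i)) * ?d"
    unfolding 2[symmetric] by (simp add: mult_ac)
  also have "\<dots> = ?d ^ n * (?d * det (mat n n w))" unfolding 1 by (simp add: mult_ac)
  finally have "(\<Prod>i = 0..<n. b i) = ?d * det (mat n n w)" using assms(2) by simp
  then show ?thesis by simp
qed

context pruefer_dim_le_one
begin

lemma invertible_frac_ideal_gen_pair: "invertible_frac_ideal (frac_ideal_gen {to_fract a, to_fract d})"
proof -
  have "to_fract d \<in> frac_ideal_gen (to_fract ` {a, d})" by (rule fract_mod.span_base) simp
  then have "frac_ideal_gen (to_fract ` {a, d}) \<noteq> {0}" using d_nonzero by auto
  with pruefer[unfolded pruefer_domain_def, rule_format, of "{a, d}"] show ?thesis by simp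
qed

lemma invertible_frac_ideal_gen_one: "invertible_frac_ideal (frac_ideal_gen {1 :: 'a fract})"
proof -
  have "1 \<in> frac_ideal_gen (to_fract ` {1 :: 'a})" by (rule fract_mod.span_base) simp
  then have "frac_ideal_gen (to_fract ` {1 :: 'a}) \<noteq> {0}" by auto
  with pruefer[unfolded pruefer_domain_def, rule_format, of "{1 :: 'a}"] show ?thesis by simp
qed

end

theorem proposition4p8:
  fixes M :: "'a::idom mat" and n :: nat and d :: 'a
  assumes "pruefer_domain TYPE('a)"
    and "dimension_le_one TYPE('a)"
    and "M \<in> carrier_mat n n"
    and "d = det M"
    and "d \<noteq> 0"
  shows "\<exists>\<aa>. length \<aa> = n \<and>
    pseudo_mat_equiv
      (Pseudo_Mat (replicate n (frac_ideal_gen {1})) (replicate n (frac_ideal_gen {1}))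
        (map_mat to_fract M))
      (Pseudo_Mat (replicate n (frac_ideal_gen {1})) \<aa> (1\<^sub>m n)) \<and>
    sorted_wrt (\<supseteq>) \<aa> \<and>
    frac_ideal_prod \<aa> = frac_ideal_gen {to_fract d} \<and>
    (\<forall>I\<in>set \<aa>. \<exists>a::'a. I = frac_ideal_gen {to_fract a, to_fract d})"
proof -
  interpret pruefer_dim_le_one d using assms by unfold_locales
  interpret to_fract: comm_ring_hom "to_fract :: 'a \<Rightarrow> 'a fract" by unfold_locales simp_all
  note [simp del] = index_mult_mat(1)
  obtain L C where L: "L \<in> carrier_mat n n" and C: "C \<in> carrier_mat n n"
    and det: "det L = 1" "det C = 1"
    and off: "\<And>i j. i < n \<Longrightarrow> j < n \<Longrightarrow> i \<noteq> j \<Longrightarrow> d dvd (L * M * C) $$ (i, j)"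
    and chain: "\<And>i j. i < j \<Longrightarrow> j < n \<Longrightarrow> dvd_mod d ((L * M * C) $$ (i, i)) ((L * M * C) $$ (j, j))"
    using smith_normal_form_mod[OF assms(3)] by blast
  define P where "P = L * M"
  have P: "P \<in> carrier_mat n n" using L assms(3) by (simp add: P_def)
  have detP: "det P = d" using det_mult[OF L assms(3)] det(1) assms(4) by (simp add: P_def)
  have PC: "P * C \<in> carrier_mat n n" using P C by simp
  define Y where "Y = adj_mat P"
  have Y: "Y \<in> carrier_mat n n" "P * Y = d \<cdot>\<^sub>m 1\<^sub>m n" "Y * P = d \<cdot>\<^sub>m 1\<^sub>m n"
    using adj_mat[OF P] by (simp_all add: Y_def detP)
  define a where "a i = (P * C) $$ (i, i)" for i
  define I where "I i = frac_ideal_gen {to_fract (a i), to_fract d}" for i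
  let ?as = "map I [0..<n]"
  let ?ones = "replicate n (frac_ideal_gen {1 :: 'a fract})"

  \<comment> \<open>As \<open>C\<close> is invertible over the domain, row \<open>i\<close> of
    \<open>P\<close> consists of combinations of row \<open>i\<close> of \<open>P * C\<close>, which
    is \<open>a i\<close> on the diagonal and divisible by \<open>d\<close> elsewhere.\<close>
  have P_mem: "dvd_mod d (a i) (P $$ (i, j))" if "i < n" "j < n" for i j
  proof -
    note C' = adj_mat[OF C]
    have "P = (P * C) * adj_mat C"
      using P C C' by (simp add: assoc_mult_mat[of _ n n _ n _ n] det one_smult_mat)
    then have "P $$ (i, j) = (\<Sum>k<n. (P * C) $$ (i, k) * adj_mat C $$ (k, j))"
      using index_mult_mat_sum[OF PC C'(1) that] by simp
    moreover have "dvd_mod d (a i) ((P * C) $$ (i, k))" if "k < n" for k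
      using off[of i k] \<open>i < n\<close> that
      by (cases "i = k") (auto simp: a_def P_def intro: dvd_mod_refl dvd_mod_of_dvd)
    ultimately show ?thesis by (auto intro!: dvd_mod_sum dvd_mod_mult_right)
  qed
  \<comment> \<open>In column \<open>j\<close> of \<open>Y * (P * C) = d C\<close> only the diagonal
    term \<open>Y $$ (i, j) * a j\<close> is not visibly divisible by \<open>d\<close>. The outcome
    is that \<open>Y / d\<close>, the inverse of \<open>P\<close>, maps the ideals
    \<open>I j\<close> into the domain.\<close>
  have Y_dvd: "d dvd Y $$ (i, j) * b" if ij: "i < n" "j < n" and b: "dvd_mod d (a j) b" for i j b
  proof -
    have "Y * (P * C) = d \<cdot>\<^sub>m C"
      using Y P C by (simp flip: assoc_mult_mat[of _ n n _ n _ n] add: mult_smult_assoc_mat[of _ n n])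
    then have "(\<Sum>k<n. Y $$ (i, k) * (P * C) $$ (k, j)) = d * C $$ (i, j)"
      using index_mult_mat_sum[OF Y(1) PC ij] C ij by simp
    moreover have "(\<Sum>k<n. Y $$ (i, k) * (P * C) $$ (k, j))
      = Y $$ (i, j) * a j + (\<Sum>k\<in>{..<n} - {j}. Y $$ (i, k) * (P * C) $$ (k, j))"
      using ij by (simp add: sum.remove[of _ j] a_def)
    ultimately have "d dvd Y $$ (i, j) * a j + (\<Sum>k\<in>{..<n} - {j}. Y $$ (i, k) * (P * C) $$ (k, j))"
      by simp
    moreover have "d dvd (\<Sum>k\<in>{..<n} - {j}. Y $$ (i, k) * (P * C) $$ (k, j))"
      using off ij by (intro dvd_sum dvd_mult) (auto simp: P_def)
    ultimately have Ya: "d dvd Y $$ (i, j) * a j"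
      by (simp only: dvd_add_left_iff)
    obtain m where "d dvd b - m * a j" using b by (auto simp: dvd_mod_def)
    then have "d dvd Y $$ (i, j) * (b - m * a j) + m * (Y $$ (i, j) * a j)"
      using Ya by simp
    then show ?thesis by (simp add: algebra_simps)
  qed
  have I_eq: "I i = to_fract ` {z. dvd_mod d (a i) z}" for i
    by (simp add: I_def frac_ideal_gen_pair)

  have "sorted_wrt (\<supseteq>) ?as"
    using chain by (auto simp: sorted_wrt_iff_nth_less I_eq a_def P_def intro: dvd_mod_trans)
  moreover have "frac_ideal_prod ?as = frac_ideal_gen {to_fract d}"
  proof
    \<comment> \<open>The factor \<open>1\<close> is the starting value of \<open>c\<close> in
      \<open>frac_ideal_prod_induct\<close>; \<open>det_dvd_prod\<close> handles the products of
      chosen elements.\<close>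
    have "1 * y \<in> frac_ideal_gen {to_fract d}" if "y \<in> frac_ideal_prod ?as" for y
    proof (rule frac_ideal_prod_induct[OF fract_mod.subspace_span _ that])
      fix xs assume xs: "list_all2 (\<in>) xs ?as"
      then have len: "length xs = n" by (auto dest: list_all2_lengthD)
      have "\<forall>i\<in>{..<n}. \<exists>b. xs ! i = to_fract b \<and> dvd_mod d (a i) b"
        using xs len by (auto simp: list_all2_conv_all_nth I_eq)
      then obtain b where b: "\<And>i. i < n \<Longrightarrow> xs ! i = to_fract (b i)"
        "\<And>i. i < n \<Longrightarrow> dvd_mod d (a i) (b i)"
        unfolding bchoice_iff by auto
      have "det P dvd (\<Prod>i = 0..<n. b i)"
        using Y_dvd b(2) assms(5) by (intro det_dvd_prod[OF P]) (auto simp: detP simp flip: Y_def)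
      then obtain k where "(\<Prod>i = 0..<n. b i) = k * d" by (auto simp: detP dvd_def mult.commute)
      moreover have "prod_list xs = to_fract (\<Prod>i = 0..<n. b i)"
        using b(1) len by (simp add: prod.list_conv_set_nth to_fract.hom_prod)
      ultimately show "1 * prod_list xs \<in> frac_ideal_gen {to_fract d}"
        by (auto simp: fract_mod.span_singleton)
    qed
    then show "frac_ideal_prod ?as \<subseteq> frac_ideal_gen {to_fract d}" by auto
    have "to_fract d \<in> frac_ideal_prod ?as"
      using det_in_frac_ideal_prod[OF P, of I] P_mem by (simp add: I_eq detP)
    then show "frac_ideal_gen {to_fract d} \<subseteq> frac_ideal_prod ?as"
      by (intro fract_mod.span_minimal frac_submodule_frac_ideal_prod) simp
  qed
  moreover have "pseudo_mat_equiv (Pseudo_Mat ?ones ?ones (map_mat to_fract M)) (Pseudo_Mat ?ones ?as (1\<^sub>m n))"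
  proof -
    let ?h = "map_mat (to_fract :: 'a \<Rightarrow> 'a fract)"
    \<comment> \<open>\<open>X\<close> is the inverse of \<open>P = L * M\<close> over the field of
      fractions. It, not \<open>C\<close>, is the right factor of the equivalence.
      \<open>Y_dvd\<close> makes \<open>X\<close> a pseudo-matrix and \<open>P_mem\<close> does the
      same for its inverse.\<close>
    define X where "X = inverse (to_fract d) \<cdot>\<^sub>m ?h Y"
    have X: "X \<in> carrier_mat n n" using Y(1) by (simp add: X_def)
    have h_d: "inverse (to_fract d) \<cdot>\<^sub>m ?h (d \<cdot>\<^sub>m 1\<^sub>m n) = 1\<^sub>m n"
      using assms(5) by (intro eq_matI) auto
    have PX: "?h P * X = 1\<^sub>m n"
      using P Y(1,2) h_d unfolding X_def
      by (simp add: mult_smult_distrib[of _ n n] flip: to_fract.mat_hom_mult[of _ n n])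
    have XP: "X * ?h P = 1\<^sub>m n"
      using P Y(1,3) h_d unfolding X_def
      by (simp add: mult_smult_assoc_mat[of _ n n] flip: to_fract.mat_hom_mult[of _ n n])
    have unimodular: "is_pseudo_mat (Pseudo_Mat ?ones ?ones (?h A))" if "A \<in> carrier_mat n n" for A
      using that invertible_frac_ideal_gen_one
      by (auto simp: is_pseudo_mat_def frac_ideal_gen_one simp flip: to_fract_mult)
    have I_inv: "\<forall>J\<in>set ?as. invertible_frac_ideal J"
      using invertible_frac_ideal_gen_pair by (auto simp: I_def)
    have diagonal: "is_pseudo_mat (Pseudo_Mat ?ones ?as (1\<^sub>m n))"
      using I_inv invertible_frac_ideal_gen_one
      by (auto simp: is_pseudo_mat_def frac_ideal_gen_one I_eq split: if_splits
          intro: range_eqI[of _ _ 0])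
    have "invertible_pseudo_mat (Pseudo_Mat ?ones ?ones (?h L))"
    proof -
      note L' = adj_mat[OF L]
      have "?h L * ?h (adj_mat L) = 1\<^sub>m n" "?h (adj_mat L) * ?h L = 1\<^sub>m n"
        using L L' by (simp_all add: det one_smult_mat flip: to_fract.mat_hom_mult[of _ n n])
           (simp_all add: to_fract.mat_hom_one)
      then show ?thesis using unimodular L L'(1)
        unfolding invertible_pseudo_mat_def inverts_mat_def
        by (auto intro!: exI[of _ "?h (adj_mat L)"])
    qed
    moreover have "invertible_pseudo_mat (Pseudo_Mat ?ones ?as X)"
    proof -
      have "X $$ (i, j) * x \<in> range to_fract" if ij: "i < n" "j < n" and x: "x \<in> I j" for i j x
      proof -
        obtain b where b: "x = to_fract b" "dvd_mod d (a j) b" using x by (auto simp: I_eq)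
        with Y_dvd[OF ij] obtain k where "Y $$ (i, j) * b = d * k" by (auto simp: dvd_def)
        then have "to_fract (Y $$ (i, j)) * to_fract b = to_fract d * to_fract k"
          by (simp flip: to_fract_mult)
        then have "X $$ (i, j) * x = to_fract k"
          using ij Y(1) assms(5) b by (simp add: X_def mult.assoc)
        then show ?thesis by simp
      qed
      then have 1: "is_pseudo_mat (Pseudo_Mat ?ones ?as X)"
        using X I_inv invertible_frac_ideal_gen_one
        by (auto simp: is_pseudo_mat_def frac_ideal_gen_one)
      have "to_fract (P $$ (i, j)) * x \<in> I i" if "i < n" "j < n" "x \<in> range to_fract" for i j x
        using that P_mem[OF that(1,2)]
        by (auto simp: I_eq simp flip: to_fract_mult intro: dvd_mod_mult_right)
      then have 2: "is_pseudo_mat (Pseudo_Mat ?as ?ones (?h P))"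
        using P I_inv invertible_frac_ideal_gen_one
        by (auto simp: is_pseudo_mat_def frac_ideal_gen_one)
      show ?thesis using 1 2 X P XP PX unfolding invertible_pseudo_mat_def inverts_mat_def
        by (auto intro!: exI[of _ "?h P"])
    qed
    moreover have "?h L * ?h M * X = 1\<^sub>m n"
      using PX L assms(3) by (simp add: P_def to_fract.mat_hom_mult[of _ n n])
    ultimately have "invertible_pseudo_mat (Pseudo_Mat ?ones ?ones (?h L)) \<and>
      invertible_pseudo_mat (Pseudo_Mat ?ones ?as X) \<and>
      col_ideals (Pseudo_Mat ?ones ?ones (?h L)) = row_ideals (Pseudo_Mat ?ones ?ones (?h M)) \<and>
      col_ideals (Pseudo_Mat ?ones ?ones (?h M)) = row_ideals (Pseudo_Mat ?ones ?as X) \<and>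
      Pseudo_Mat ?ones ?as (1\<^sub>m n) = pseudo_mat_mult
        (pseudo_mat_mult (Pseudo_Mat ?ones ?ones (?h L)) (Pseudo_Mat ?ones ?ones (?h M)))
        (Pseudo_Mat ?ones ?as X)"
      by (simp add: pseudo_mat_mult_def)
    then show ?thesis using unimodular[OF assms(3)] diagonal unfolding pseudo_mat_equiv_def by blast
  qed
  ultimately show ?thesis by (intro exI[of _ ?as]) (auto simp: I_def)
qed

end
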